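(* Let $f:\mathbb{R}^d\to\mathbb{R}$ be convex, attain its minimum at some $x^*\in\mathbb{R}^d$, and be $M$-Lipschitz, i.e. $|f(x)-f(y)|\le M\|x-y\|$ for all $x,y\in\mathbb{R}^d$, for some $M\in(0,\infty]$. Let every one of the $n$ workers be able to compute stochastic (sub)gradients $\nabla f(x;\xi)$, $\xi\sim\mathcal{D}$, with $\mathbb{E}_\xi[\nabla f(x;\xi)]\in\partial f(x)$ and $\mathbb{E}_\xi[\|\nabla f(x;\xi)-\mathbb{E}_\xi[\nabla f(x;\xi)]\|^2]\le\sigma^2$ for all $x\in\mathbb{R}^d$, where $\sigma^2\ge0$. Let the computation powers $v_1,\dots,v_n:\mathbb{R}_+\to\mathbb{R}_+$ be non-negative and continuous almost everywhere, with $V_i(t)=\int_0^t v_i(\tau)d\tau$. Let $\varepsilon>0$, let $x^0$ be the starting point and $R=\|x^*-x^0\|$. Run Rennala SGD with batch size $S=\max\{\lceil\sigma^2/M^2\rceil,1\}$ and stepsize $\gamma=\frac{\varepsilon}{M^2+\sigma^2/S}\in\left[\frac{\varepsilon}{2M^2},\frac{\varepsilon}{M^2}\right]$. Define $\bar t_0=0$ and, for all $k\ge1$, $$\bar t_k:=\min\Big\{t\ge0:\sum_{i=1}^n\lfloor V_i(t)-V_i(\bar t_{k-1})\rfloor\ge\max\big\{\lceil\sigma^2/\varepsilon\rceil,1\big\}\Big\}.$$ Then Rennala SGD converges after at most $\bar t_{\lceil 2M^2R^2/\varepsilon^2\rceil}$ seconds, where convergence means the guarantee $\mathbb{E}[f(\widehat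 x^K)]-f(x^* )\le\varepsilon$ with $\widehat x^K=\frac1K\sum_{k=0}^{K-1}x^k$, reached with $K=\lceil 2M^2R^2/\varepsilon^2\rceil$ iterations.
   Context: Notation: $\mathbb{R}_+=[0,\infty)$; $\partial f(x)$ is the subdifferential; $\min\emptyset=\infty$, and $\bar t_k=\infty$ if $\bar t_{k-1}=\infty$. Computation model: $n$ workers compute in parallel and time starts at $0$. $V_i$ (Riemann integral) is continuous and non-decreasing on $\mathbb{R}_+$. The number of stochastic gradients that worker $i$ can calculate from a time $t_0$ to a time $t_1\ge t_0$ is $\lfloor V_i(t_1)-V_i(t_0)\rfloor$; only computation takes time. If the computation powers are random, they are independent of the stochastic gradient noise and everything is conditional on them. Rennala SGD (input: $x^0$, stepsize $\gamma$, batch size $S$): for $k=0,1,\dots,K-1$: the server asks all workers to compute stochastic gradients at $x^k$; whenever a worker finishes a stochastic gradient at $x^k$ the server receives it and the worker is asked to compute another stochastic gradient at $x^k$; as soon as $S$ stochastic gradients $\nabla f(x^k;\xi^k_1),\dots,\nabla f(x^k;\xi^k_S)$ (with i.i.d. samples $\xi^k_s\sim\mathcal{D}$) in total have been received, the server sets $g^k=\frac1S\sum_{s=1}^S\nabla f(x^k;\xi^k_s)$, $x^{k+1}=x^k-\gamma g^k$, stops all the workers' calculations, and goes to the next iteration.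
   Formalization: The time bound with threshold max{⌈σ²/ε⌉,1} can fail if S exceeds it (only for ε>M²), so it is stated under S≤max{⌈σ²/ε⌉,1}; it is also stated unconditionally with threshold S=max{⌈σ²/M²⌉,1}. K is taken finite (M=∞ needs R=0); for K=0 the output is x^0. *)

theory Defs
  imports "HOL-Probability.Probability"
begin

definition subdifferential :: "('a::real_inner \<Rightarrow> real) \<Rightarrow> 'a \<Rightarrow> 'a set" where
  "subdifferential f x = {g. \<forall>y. f y \<ge> f x + g \<bullet> (y - x)}"

definition ereal_ceiling :: "ereal \<Rightarrow> ereal" where
  "ereal_ceiling a = (case a of ereal r \<Rightarrow> ereal (real_of_int \<lceil>r\<rceil>) | PInfty \<Rightarrow> \<infinity> | MInfty \<Rightarrow> -\<infinity>)"


definition work :: "(nat \<Rightarrow> real \<Rightarrow> real) \<Rightarrow> nat \<Rightarrow> real \<Rightarrow> real" where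
  "work v i t = integral {0..t} (v i)"

text \<open>The number of stochastic gradients that the workers \<open>1, \<dots>, n\<close> complete together between
  times \<open>s\<close> and \<open>t\<close>, if all of them start a fresh computation at time \<open>s\<close>.\<close>

definition grads_computed :: "(nat \<Rightarrow> real \<Rightarrow> real) \<Rightarrow> nat \<Rightarrow> real \<Rightarrow> real \<Rightarrow> int" where
  "grads_computed v n s t = (\<Sum>i=1..n. \<lfloor>work v i t - work v i s\<rfloor>)"

text \<open>The minimum of a set of times, with \<open>min \<emptyset> = \<infinity>\<close>. In the uses below, nonempty sets do have a
  least element, because \<open>work v i\<close> is continuous and nondecreasing and the floor function is
  right-continuous.\<close>

definition min_time :: "real set \<Rightarrow> ereal" where
  "min_time A = (if A = {} then \<infinity> else ereal (LEAST t. t \<in> A))"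

text \<open>The bounds \<open>t_bar v n B k\<close>, with \<open>B\<close> the number of gradients required per step.\<close>

primrec t_bar :: "(nat \<Rightarrow> real \<Rightarrow> real) \<Rightarrow> nat \<Rightarrow> int \<Rightarrow> nat \<Rightarrow> ereal" where
  "t_bar v n B 0 = 0"
| "t_bar v n B (Suc k) =
     (case t_bar v n B k of
        ereal s \<Rightarrow> min_time {t. 0 \<le> t \<and> grads_computed v n s t \<ge> B}
      | _ \<Rightarrow> \<infinity>)"

text \<open>The time at which Rennala SGD with batch size \<open>S\<close> has finished its first \<open>k\<close> iterations.
  Iteration \<open>k\<close> starts when its predecessor ends; all unfinished computations are discarded at that
  moment, and the iteration ends as soon as \<open>S\<close> new gradients have been received.\<close>

primrec rennala_time :: "(nat \<Rightarrow> real \<Rightarrow> real) \<Rightarrow> nat \<Rightarrow> nat \<Rightarrow> nat \<Rightarrow> ereal" where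
  "rennala_time v n S 0 = 0"
| "rennala_time v n S (Suc k) =
     (case rennala_time v n S k of
        ereal s \<Rightarrow> min_time {t. s \<le> t \<and> grads_computed v n s t \<ge> int S}
      | _ \<Rightarrow> \<infinity>)"

text \<open>The iterates of Rennala SGD: \<open>G x z\<close> is the stochastic gradient at \<open>x\<close> for the sample \<open>z\<close>,
  and \<open>\<xi> k s\<close> is the sample of the gradient received as number \<open>s\<close> in iteration \<open>k\<close>.\<close>

primrec rennala_iterate ::
    "('a::real_vector \<Rightarrow> 'b \<Rightarrow> 'a) \<Rightarrow> real \<Rightarrow> nat \<Rightarrow> 'a \<Rightarrow> (nat \<Rightarrow> nat \<Rightarrow> 'b) \<Rightarrow> nat \<Rightarrow> 'a" where
  "rennala_iterate G \<gamma> S x0 \<xi> 0 = x0"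
| "rennala_iterate G \<gamma> S x0 \<xi> (Suc k) =
     rennala_iterate G \<gamma> S x0 \<xi> k
     - \<gamma> *\<^sub>R ((1 / real S) *\<^sub>R (\<Sum>s=1..S. G (rennala_iterate G \<gamma> S x0 \<xi> k) (\<xi> k s)))"

text \<open>For \<open>K = 0\<close> the average is empty, and the output is taken to be the starting point.\<close>

definition rennala_output ::
    "('a::real_vector \<Rightarrow> 'b \<Rightarrow> 'a) \<Rightarrow> real \<Rightarrow> nat \<Rightarrow> 'a \<Rightarrow> (nat \<Rightarrow> nat \<Rightarrow> 'b) \<Rightarrow> nat \<Rightarrow> 'a" where
  "rennala_output G \<gamma> S x0 \<xi> K =
     (if K = 0 then x0 else (1 / real K) *\<^sub>R (\<Sum>k<K. rennala_iterate G \<gamma> S x0 \<xi> k))"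

end

theory Submission
  imports Defs
begin

text \<open>
  Convergence rests on one inequality for a frozen point \<open>x\<close>. With \<open>u = x - xstar\<close> and \<open>g\<close> the mean
  of the stochastic gradient at \<open>x\<close>, a minibatch step satisfies
  \<open>E (norm (u - \<gamma> g\<^sub>S))\<^sup>2 \<le> (norm u)\<^sup>2 - 2 \<gamma> (g \<bullet> u) + \<gamma>\<^sup>2 ((norm g)\<^sup>2 + \<sigma>\<^sup>2 / S)\<close>: the noise is centred, so
  it enters only through its variance, which independence reduces by the factor \<open>S\<close>
  (\<open>expected_minibatch_step\<close>). A subgradient of an \<open>M\<close>-Lipschitz function has norm at most \<open>M\<close>, and
  \<open>g \<bullet> u \<ge> f x - f xstar\<close>. Since the iterate \<open>x\<^sup>k\<close> is a function of the samples of earlier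
  iterations, it is independent of the batch of iteration \<open>k\<close>, and Fubini permits substituting
  \<open>x\<^sup>k\<close> for \<open>x\<close> (\<open>expected_step\<close>). Telescoping over \<open>k < K\<close> and convexity yield
  \<open>R\<^sup>2 / (2 \<gamma> K) + \<gamma> (M\<^sup>2 + \<sigma>\<^sup>2 / S) / 2\<close> as a bound on the expected gap of the averaged iterate
  (\<open>expected_suboptimality\<close>). The choice of \<open>\<gamma>\<close> makes the second term \<open>\<epsilon> / 2\<close>; the choice of \<open>S\<close> gives
  \<open>\<sigma>\<^sup>2 / S \<le> M\<^sup>2\<close>, so that the choice of \<open>K\<close> makes the first term at most \<open>\<epsilon> / 2\<close>.

  The time bounds are a monotonicity argument: starting an iteration earlier and asking for fewer
  gradients can only make it end earlier, so by induction the iterations of the method never lag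
  behind the times \<open>t_bar\<close> whenever the batch size is at most the count required there
  (\<open>rennala_time_le_t_bar\<close>). For this the minima have to be attained, which holds because
  the cumulative work is continuous and the floor function is upper semicontinuous.

  If \<open>M = \<infinity>\<close>, a finite \<open>K\<close> forces \<open>R = 0\<close> and \<open>K = 0\<close>, and the starting point is already a
  minimizer.
\<close>

section \<open>Completion times\<close>

lemma work_continuous_on:
  assumes "\<And>t. 0 \<le> t \<Longrightarrow> v i integrable_on {0..t}"
  shows "continuous_on {0..} (work v i)"
proof -
  have "continuous (at t within {0..}) (work v i)" if "0 \<le> t" for t
  proof -
    have "continuous_on {0..t + 1} (work v i)"
      unfolding work_def using assms[of "t + 1"] that
      by (intro indefinite_integral_continuous_1) auto
    then have "continuous (at t within {0..t + 1}) (work v i)"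
      using that by (auto simp: continuous_on_eq_continuous_within)
    moreover have "at t within {0..t + 1} = at t within {0..}"
      by (rule at_within_nhd[of t "{..<t + 1}"]) auto
    ultimately show ?thesis by (simp only:)
  qed
  then show ?thesis by (auto simp: continuous_on_eq_continuous_within)
qed

lemma work_mono:
  assumes "\<And>t. 0 \<le> t \<Longrightarrow> v i integrable_on {0..t}" "\<And>\<tau>. 0 \<le> \<tau> \<Longrightarrow> 0 \<le> v i \<tau>"
    and "0 \<le> s" "s \<le> t"
  shows "work v i s \<le> work v i t"
  unfolding work_def using assms by (intro integral_subset_le) auto

lemma grads_computed_mono:
  assumes int: "\<And>i t. i \<in> {1..n} \<Longrightarrow> 0 \<le> t \<Longrightarrow> v i integrable_on {0..t}"
    and nonneg: "\<And>i \<tau>. i \<in> {1..n} \<Longrightarrow> 0 \<le> \<tau> \<Longrightarrow> 0 \<le> v i \<tau>"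
    and "0 \<le> s" "s \<le> s'" "0 \<le> t" "t \<le> t'"
  shows "grads_computed v n s' t \<le> grads_computed v n s t'"
  unfolding grads_computed_def
  using assms by (intro sum_mono floor_mono diff_mono work_mono) auto

text \<open>A sum of floors of continuous functions is upper semicontinuous: near \<open>t\<close> each of them
  stays below the integer that follows its value at \<open>t\<close>, so no floor exceeds its value at \<open>t\<close>.\<close>

lemma closed_grads_computed_ge:
  assumes int: "\<And>i t. i \<in> {1..n} \<Longrightarrow> 0 \<le> t \<Longrightarrow> v i integrable_on {0..t}"
  shows "closed {t. 0 \<le> t \<and> grads_computed v n s t \<ge> B}"
proof -
  have "t \<in> {t. 0 \<le> t \<and> grads_computed v n s t \<ge> B}"
    if lim: "t islimpt {t. 0 \<le> t \<and> grads_computed v n s t \<ge> B}" (is "_ islimpt ?A") for t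
  proof -
    have "t islimpt {0..}"
      using lim by (rule islimpt_subset) auto
    then have t: "0 \<le> t"
      using closed_limpt[of "{0::real..}"] by auto
    have "\<forall>\<^sub>F r in at t within {0..}. \<lfloor>work v i r - work v i s\<rfloor> \<le> \<lfloor>work v i t - work v i s\<rfloor>"
      if i: "i \<in> {1..n}" for i
    proof -
      have "((\<lambda>r. work v i r - work v i s) \<longlongrightarrow> work v i t - work v i s) (at t within {0..})"
        using work_continuous_on[of v i] int[OF i] t
        by (auto intro!: tendsto_intros simp: continuous_on_def)
      moreover have "work v i t - work v i s < real_of_int (\<lfloor>work v i t - work v i s\<rfloor> + 1)"
        by linarith
      ultimately have "\<forall>\<^sub>F r in at t within {0..}.
          work v i r - work v i s < real_of_int (\<lfloor>work v i t - work v i s\<rfloor> + 1)"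
        by (rule order_tendstoD)
      then show ?thesis
        by eventually_elim linarith
    qed
    then have "\<forall>\<^sub>F r in at t within {0..}. \<forall>i\<in>{1..n}.
        \<lfloor>work v i r - work v i s\<rfloor> \<le> \<lfloor>work v i t - work v i s\<rfloor>"
      by (intro eventually_ball_finite) auto
    then have "\<forall>\<^sub>F r in at t within {0..}. grads_computed v n s r \<le> grads_computed v n s t"
      by eventually_elim (auto simp: grads_computed_def intro!: sum_mono)
    then have "\<forall>\<^sub>F r in at t within ?A. grads_computed v n s r \<le> grads_computed v n s t"
      by (rule filter_leD[rotated]) (rule at_le, auto)
    moreover have "\<forall>\<^sub>F r in at t within ?A. r \<in> ?A"
      by (simp add: eventually_at_filter)
    ultimately have "\<forall>\<^sub>F r in at t within ?A. B \<le> grads_computed v n s t"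
      by eventually_elim auto
    then have "B \<le> grads_computed v n s t"
      using lim by (simp add: trivial_limit_within)
    with t show ?thesis by auto
  qed
  then show ?thesis
    unfolding closed_limpt by blast
qed

text \<open>The definition of \<open>min_time\<close> through \<open>LEAST\<close> says nothing unless a least element exists;
  closedness provides it.\<close>

lemma min_time_eq_Inf:
  assumes "closed A" "A \<subseteq> {0..}" "A \<noteq> {}"
  shows "min_time A = ereal (Inf A)" "Inf A \<in> A"
proof -
  have bdd: "bdd_below A"
    using assms(2) by (auto intro!: bdd_belowI[of _ 0])
  show "Inf A \<in> A"
    using assms bdd by (intro closed_contains_Inf) auto
  then have "(LEAST t. t \<in> A) = Inf A"
    using bdd by (intro Least_equality cInf_lower) auto
  then show "min_time A = ereal (Inf A)"
    using assms by (simp add: min_time_def)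
qed

lemma min_time_antimono:
  assumes "closed A" "A \<subseteq> {0..}" "closed B" "B \<subseteq> A"
  shows "min_time A \<le> min_time B"
proof (cases "B = {}")
  case False
  then have "A \<noteq> {}" using assms by auto
  have "bdd_below A"
    using assms(2) by (auto intro!: bdd_belowI[of _ 0])
  then have "Inf A \<le> Inf B"
    using False assms by (intro cInf_superset_mono) auto
  then show ?thesis
    using False \<open>A \<noteq> {}\<close> assms min_time_eq_Inf[of A] min_time_eq_Inf[of B] by auto
qed (simp add: min_time_def)

lemma min_time_nonneg:
  assumes "closed A" "A \<subseteq> {0..}"
  shows "0 \<le> min_time A"
proof (cases "A = {}")
  case False
  show ?thesis
    using min_time_eq_Inf[OF assms False] assms(2) by auto
qed (simp add: min_time_def)

lemma closed_grads_computed_ge_after: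
  assumes int: "\<And>i t. i \<in> {1..n} \<Longrightarrow> 0 \<le> t \<Longrightarrow> v i integrable_on {0..t}"
    and "0 \<le> s"
  shows "closed {t. s \<le> t \<and> grads_computed v n s t \<ge> B}"
proof -
  have "{t. s \<le> t \<and> grads_computed v n s t \<ge> B}
      = {t. 0 \<le> t \<and> grads_computed v n s t \<ge> B} \<inter> {s..}"
    using \<open>0 \<le> s\<close> by auto
  then show ?thesis
    using closed_grads_computed_ge[where n=n and v=v and s=s and B=B] int by (simp add: closed_Int)
qed

lemma rennala_time_nonneg:
  assumes int: "\<And>i t. i \<in> {1..n} \<Longrightarrow> 0 \<le> t \<Longrightarrow> v i integrable_on {0..t}"
  shows "0 \<le> rennala_time v n S k"
proof (induction k)
  case (Suc k)
  then show ?case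
    using int by (cases "rennala_time v n S k")
      (auto intro!: min_time_nonneg closed_grads_computed_ge_after)
qed simp

text \<open>The two recursions differ in three ways: the start of the iteration, the number of gradients, and
  the range of admissible end times. The first two make the set of end times of the method the larger
  one. As for the range, \<open>1 \<le> B\<close> excludes end times before the start, since no gradient is completed
  by then.\<close>

lemma rennala_time_le_t_bar:
  assumes int: "\<And>i t. i \<in> {1..n} \<Longrightarrow> 0 \<le> t \<Longrightarrow> v i integrable_on {0..t}"
    and nonneg: "\<And>i \<tau>. i \<in> {1..n} \<Longrightarrow> 0 \<le> \<tau> \<Longrightarrow> 0 \<le> v i \<tau>"
    and B: "int S \<le> B" "1 \<le> B"
  shows "rennala_time v n S k \<le> t_bar v n B k"
proof (induction k)
  case (Suc k)
  let ?A = "\<lambda>s. {t. s \<le> t \<and> grads_computed v n s t \<ge> int S}"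
  let ?B = "\<lambda>s. {t. 0 \<le> t \<and> grads_computed v n s t \<ge> B}"
  have nn: "0 \<le> rennala_time v n S k"
    using int by (rule rennala_time_nonneg)
  show ?case
  proof (cases "t_bar v n B k")
    case (real s')
    then obtain s where s: "rennala_time v n S k = ereal s" "0 \<le> s" "s \<le> s'"
      using Suc nn by (cases "rennala_time v n S k") auto
    have "?B s' \<subseteq> ?A s"
    proof clarify
      fix t :: real assume t: "0 \<le> t" "B \<le> grads_computed v n s' t"
      have "int S \<le> grads_computed v n s t"
        using grads_computed_mono[where v=v and n=n and s=s and s'=s' and t=t and t'=t, OF int nonneg]
          s t B by simp
      moreover have "s \<le> t"
      proof (rule ccontr)
        assume "\<not> s \<le> t"
        then have "grads_computed v n s' t \<le> grads_computed v n s' s'"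
          using s t by (intro grads_computed_mono int nonneg) auto
        also have "\<dots> = 0" by (simp add: grads_computed_def)
        finally show False using t B by simp
      qed
      ultimately show "s \<le> t \<and> int S \<le> grads_computed v n s t" by simp
    qed
    then have "min_time (?A s) \<le> min_time (?B s')"
      using s int
      by (intro min_time_antimono closed_grads_computed_ge closed_grads_computed_ge_after) auto
    then show ?thesis using real s by simp
  qed (use Suc nn in auto)
qed simp

section \<open>One step of a minibatch subgradient method\<close>

text \<open>Along its own direction a subgradient forces growth of \<open>f\<close> at rate \<open>norm g\<close>.\<close>

lemma subgradient_norm_le_Lipschitz:
  fixes f :: "'a::real_inner \<Rightarrow> real"
  assumes "g \<in> subdifferential f x" and Lip: "\<And>x y. \<bar>f x - f y\<bar> \<le> L * norm (x - y)"
    and "0 \<le> L"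
  shows "norm g \<le> L"
proof (cases "g = 0")
  case False
  have "f (x + g) \<ge> f x + g \<bullet> g"
    using assms(1) unfolding subdifferential_def by (auto dest: spec[of _ "x + g"])
  then have "norm g * norm g \<le> L * norm g"
    using Lip[of "x + g" x] by (simp add: power2_norm_eq_inner[symmetric] power2_eq_square)
  then show ?thesis using False by simp
qed (use assms in auto)

context prob_space
begin

text \<open>The form of conditioning on \<open>X\<close> used below: the joint law of independent variables is a product,
  so \<open>X\<close> may be frozen while the expectation over \<open>Y\<close> is taken. The inner integral is written over
  the original space, which lets the bound for a frozen point be proved there as well.\<close>

lemma nn_integral_indep_var:
  assumes ind: "indep_var S X T Y"
    and h[measurable]: "(\<lambda>(x, y). h x y) \<in> borel_measurable (S \<Otimes>\<^sub>M T)"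
  shows "(\<integral>\<^sup>+\<omega>. h (X \<omega>) (Y \<omega>) \<partial>M) = (\<integral>\<^sup>+\<omega>. (\<integral>\<^sup>+\<omega>'. h (X \<omega>) (Y \<omega>') \<partial>M) \<partial>M)"
proof -
  have X[measurable]: "X \<in> measurable M S" and Y[measurable]: "Y \<in> measurable M T"
    and eq: "distr M S X \<Otimes>\<^sub>M distr M T Y = distr M (S \<Otimes>\<^sub>M T) (\<lambda>\<omega>. (X \<omega>, Y \<omega>))"
    using ind by (auto simp: indep_var_distribution_eq)
  interpret Y: prob_space "distr M T Y" by (rule prob_space_distr) fact
  have "(\<integral>\<^sup>+\<omega>. h (X \<omega>) (Y \<omega>) \<partial>M) =
      (\<integral>\<^sup>+p. (\<lambda>(x, y). h x y) p \<partial>distr M (S \<Otimes>\<^sub>M T) (\<lambda>\<omega>. (X \<omega>, Y \<omega>)))"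
    by (subst nn_integral_distr) (auto simp: split_beta')
  also have "\<dots> = (\<integral>\<^sup>+x. \<integral>\<^sup>+y. h x y \<partial>distr M T Y \<partial>distr M S X)"
    unfolding eq[symmetric] by (subst Y.nn_integral_fst[symmetric]) (auto cong: measurable_cong_sets)
  also have "\<dots> = (\<integral>\<^sup>+x. \<integral>\<^sup>+\<omega>'. h x (Y \<omega>') \<partial>M \<partial>distr M S X)"
    by (intro nn_integral_cong nn_integral_distr) auto
  also have "\<dots> = (\<integral>\<^sup>+\<omega>. \<integral>\<^sup>+\<omega>'. h (X \<omega>) (Y \<omega>') \<partial>M \<partial>M)"
    by (intro nn_integral_distr) auto
  finally show ?thesis .
qed

lemma indep_var_inner:
  fixes X Y :: "'a \<Rightarrow> 'e::euclidean_space"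
  assumes ind: "indep_var borel X borel Y" and X: "integrable M X" and Y: "integrable M Y"
  shows "integrable M (\<lambda>\<omega>. X \<omega> \<bullet> Y \<omega>)"
    and "expectation (\<lambda>\<omega>. X \<omega> \<bullet> Y \<omega>) = expectation X \<bullet> expectation Y"
proof -
  have ind': "indep_var borel (\<lambda>\<omega>. X \<omega> \<bullet> b) borel (\<lambda>\<omega>. Y \<omega> \<bullet> b)" for b
    using indep_var_compose[OF ind, of "\<lambda>x. x \<bullet> b" borel "\<lambda>x. x \<bullet> b" borel] by (simp add: comp_def)
  have int: "integrable M (\<lambda>\<omega>. (X \<omega> \<bullet> b) * (Y \<omega> \<bullet> b))" for b
    using ind' X Y by (intro indep_var_integrable) auto
  have eq: "X \<omega> \<bullet> Y \<omega> = (\<Sum>b\<in>Basis. (X \<omega> \<bullet> b) * (Y \<omega> \<bullet> b))" for \<omega>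
    by (rule euclidean_inner)
  show "integrable M (\<lambda>\<omega>. X \<omega> \<bullet> Y \<omega>)"
    unfolding eq using int by auto
  have "expectation (\<lambda>\<omega>. X \<omega> \<bullet> Y \<omega>) = (\<Sum>b\<in>Basis. expectation (\<lambda>\<omega>. (X \<omega> \<bullet> b) * (Y \<omega> \<bullet> b)))"
    unfolding eq using int by (subst Bochner_Integration.integral_sum) auto
  also have "\<dots> = (\<Sum>b\<in>Basis. (expectation X \<bullet> b) * (expectation Y \<bullet> b))"
    using ind' X Y by (intro sum.cong refl) (subst indep_var_lebesgue_integral, auto)
  also have "\<dots> = expectation X \<bullet> expectation Y"
    by (rule euclidean_inner[symmetric])
  finally show "expectation (\<lambda>\<omega>. X \<omega> \<bullet> Y \<omega>) = expectation X \<bullet> expectation Y" .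
qed

text \<open>Expanding the square, the mixed terms vanish by independence.\<close>

lemma variance_sum_indep_vars:
  fixes Z :: "'i \<Rightarrow> 'a \<Rightarrow> 'e::euclidean_space"
  assumes "finite J" and ind: "indep_vars (\<lambda>_. borel) Z J"
    and int: "\<And>j. j \<in> J \<Longrightarrow> integrable M (Z j)"
    and centred: "\<And>j. j \<in> J \<Longrightarrow> expectation (Z j) = 0"
    and sq: "\<And>j. j \<in> J \<Longrightarrow> integrable M (\<lambda>\<omega>. (norm (Z j \<omega>))\<^sup>2)"
  shows "integrable M (\<lambda>\<omega>. (norm (\<Sum>j\<in>J. Z j \<omega>))\<^sup>2)"
    and "expectation (\<lambda>\<omega>. (norm (\<Sum>j\<in>J. Z j \<omega>))\<^sup>2) = (\<Sum>j\<in>J. expectation (\<lambda>\<omega>. (norm (Z j \<omega>))\<^sup>2))"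
proof -
  have eq: "(norm (\<Sum>j\<in>J. Z j \<omega>))\<^sup>2 = (\<Sum>i\<in>J. \<Sum>j\<in>J. Z i \<omega> \<bullet> Z j \<omega>)" for \<omega>
    by (simp add: power2_norm_eq_inner inner_sum_left inner_sum_right inner_commute)
  have ind2: "indep_var borel (Z i) borel (Z j)" if "i \<in> J" "j \<in> J" "i \<noteq> j" for i j
  proof -
    have "indep_var borel ((\<lambda>w. w i) \<circ> (\<lambda>\<omega>. restrict (\<lambda>k. Z k \<omega>) {i}))
        borel ((\<lambda>w. w j) \<circ> (\<lambda>\<omega>. restrict (\<lambda>k. Z k \<omega>) {j}))"
      using that by (intro indep_var_compose[OF indep_var_restrict[OF ind]]) auto
    then show ?thesis by (simp add: comp_def)
  qed
  have pair: "integrable M (\<lambda>\<omega>. Z i \<omega> \<bullet> Z j \<omega>)"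
    and pair_E: "expectation (\<lambda>\<omega>. Z i \<omega> \<bullet> Z j \<omega>) =
      (if i = j then expectation (\<lambda>\<omega>. (norm (Z i \<omega>))\<^sup>2) else 0)"
    if "i \<in> J" "j \<in> J" for i j
    using that sq[of i] indep_var_inner[OF ind2[of i j] int int] centred
    by (cases "i = j"; simp add: power2_norm_eq_inner)+
  show "integrable M (\<lambda>\<omega>. (norm (\<Sum>j\<in>J. Z j \<omega>))\<^sup>2)"
    unfolding eq using pair by auto
  have "expectation (\<lambda>\<omega>. (norm (\<Sum>j\<in>J. Z j \<omega>))\<^sup>2)
      = (\<Sum>i\<in>J. \<Sum>j\<in>J. expectation (\<lambda>\<omega>. Z i \<omega> \<bullet> Z j \<omega>))"
    unfolding eq using pair by (simp add: Bochner_Integration.integral_sum)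
  also have "\<dots> = (\<Sum>i\<in>J. \<Sum>j\<in>J. if i = j then expectation (\<lambda>\<omega>. (norm (Z i \<omega>))\<^sup>2) else 0)"
    by (intro sum.cong refl pair_E)
  also have "\<dots> = (\<Sum>j\<in>J. expectation (\<lambda>\<omega>. (norm (Z j \<omega>))\<^sup>2))"
    using \<open>finite J\<close> by simp
  finally show "expectation (\<lambda>\<omega>. (norm (\<Sum>j\<in>J. Z j \<omega>))\<^sup>2)
      = (\<Sum>j\<in>J. expectation (\<lambda>\<omega>. (norm (Z j \<omega>))\<^sup>2))" .
qed

text \<open>Writing the batch mean as \<open>g\<close> plus centred noise, the noise is orthogonal in expectation to the
  deterministic step \<open>u - \<gamma> g\<close>, so only its variance is added to the square of that step.\<close>

lemma expected_minibatch_step: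
  fixes Z :: "'i \<Rightarrow> 'a \<Rightarrow> 'e::euclidean_space" and g u :: 'e
  assumes J: "finite J" "J \<noteq> {}" and ind: "indep_vars (\<lambda>_. borel) Z J"
    and int: "\<And>j. j \<in> J \<Longrightarrow> integrable M (Z j)"
    and mean: "\<And>j. j \<in> J \<Longrightarrow> expectation (Z j) = g"
    and sq: "\<And>j. j \<in> J \<Longrightarrow> integrable M (\<lambda>\<omega>. (norm (Z j \<omega> - g))\<^sup>2)"
    and var: "\<And>j. j \<in> J \<Longrightarrow> expectation (\<lambda>\<omega>. (norm (Z j \<omega> - g))\<^sup>2) \<le> V"
  shows "integrable M (\<lambda>\<omega>. (norm (u - \<gamma> *\<^sub>R ((1 / card J) *\<^sub>R (\<Sum>j\<in>J. Z j \<omega>))))\<^sup>2)" (is ?int)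
    and "expectation (\<lambda>\<omega>. (norm (u - \<gamma> *\<^sub>R ((1 / card J) *\<^sub>R (\<Sum>j\<in>J. Z j \<omega>))))\<^sup>2)
      \<le> (norm u)\<^sup>2 - 2 * \<gamma> * (g \<bullet> u) + \<gamma>\<^sup>2 * ((norm g)\<^sup>2 + V / card J)" (is ?le)
proof -
  define c where "c = real (card J)"
  have c: "c > 0" using J by (simp add: c_def card_gt_0_iff)
  define N where "N \<omega> = (\<Sum>j\<in>J. Z j \<omega> - g)" for \<omega>
  have indc: "indep_vars (\<lambda>_. borel) (\<lambda>j \<omega>. Z j \<omega> - g) J"
    using ind by (rule indep_vars_compose2[where Y="\<lambda>_ z. z - g"]) auto
  have cent: "expectation (\<lambda>\<omega>. Z j \<omega> - g) = 0" if "j \<in> J" for j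
    using that int mean by (simp add: prob_space)
  have N_int: "integrable M N"
    unfolding N_def using int by auto
  have N_E: "expectation N = 0"
    unfolding N_def using int cent by (subst Bochner_Integration.integral_sum) auto
  note N = variance_sum_indep_vars[OF J(1) indc _ cent sq, folded N_def]
  have N_sq: "integrable M (\<lambda>\<omega>. (norm (N \<omega>))\<^sup>2)"
    using int by (intro N) auto
  have N_var: "expectation (\<lambda>\<omega>. (norm (N \<omega>))\<^sup>2) \<le> c * V"
  proof -
    have "expectation (\<lambda>\<omega>. (norm (N \<omega>))\<^sup>2) = (\<Sum>j\<in>J. expectation (\<lambda>\<omega>. (norm (Z j \<omega> - g))\<^sup>2))"
      using int by (intro N) auto
    also have "\<dots> \<le> (\<Sum>j\<in>J. V)" by (intro sum_mono var)
    finally show ?thesis by (simp add: c_def)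
  qed
  define a where "a = u - \<gamma> *\<^sub>R g"
  have "(norm (u - \<gamma> *\<^sub>R ((1 / card J) *\<^sub>R (\<Sum>j\<in>J. Z j \<omega>))))\<^sup>2
      = (norm a)\<^sup>2 - 2 * (\<gamma> / c) * (a \<bullet> N \<omega>) + (\<gamma> / c)\<^sup>2 * (norm (N \<omega>))\<^sup>2" for \<omega>
  proof -
    have "(\<Sum>j\<in>J. Z j \<omega>) = N \<omega> + c *\<^sub>R g"
      by (simp add: N_def sum_subtractf c_def sum_constant_scaleR del: sum_constant)
    then have "u - \<gamma> *\<^sub>R ((1 / card J) *\<^sub>R (\<Sum>j\<in>J. Z j \<omega>)) = a - (\<gamma> / c) *\<^sub>R N \<omega>"
      using c by (simp add: a_def c_def[symmetric] algebra_simps)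
    then show ?thesis
      by (simp only: power2_norm_eq_inner)
        (simp add: inner_diff_left inner_diff_right inner_commute power2_eq_square)
  qed
  note eq = this
  show ?int
    unfolding eq using N_int N_sq by auto
  have "expectation (\<lambda>\<omega>. (norm (u - \<gamma> *\<^sub>R ((1 / card J) *\<^sub>R (\<Sum>j\<in>J. Z j \<omega>))))\<^sup>2)
      = (norm a)\<^sup>2 + (\<gamma> / c)\<^sup>2 * expectation (\<lambda>\<omega>. (norm (N \<omega>))\<^sup>2)"
    unfolding eq using N_int N_sq N_E by (simp add: prob_space)
  also have "\<dots> \<le> (norm a)\<^sup>2 + (\<gamma> / c)\<^sup>2 * (c * V)"
    using N_var by (intro add_left_mono mult_left_mono) auto
  also have "\<dots> = (norm u)\<^sup>2 - 2 * \<gamma> * (g \<bullet> u) + \<gamma>\<^sup>2 * ((norm g)\<^sup>2 + V / card J)"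
    using c unfolding a_def c_def[symmetric]
    by (simp only: power2_norm_eq_inner)
      (simp add: inner_diff_left inner_diff_right inner_commute power2_eq_square field_simps)
  finally show ?le .
qed

end

section \<open>Convergence rate\<close>

lemma rennala_iterate_cong:
  assumes "\<And>j s. j < k \<Longrightarrow> s \<in> {1..S} \<Longrightarrow> \<xi> j s = \<xi>' j s"
  shows "rennala_iterate G \<gamma> S x0 \<xi> k = rennala_iterate G \<gamma> S x0 \<xi>' k"
  using assms
proof (induction k)
  case (Suc k)
  then have "rennala_iterate G \<gamma> S x0 \<xi> k = rennala_iterate G \<gamma> S x0 \<xi>' k"
    by simp
  moreover have "(\<Sum>s=1..S. G x (\<xi> k s)) = (\<Sum>s=1..S. G x (\<xi>' k s))" for x
    using Suc.prems by (intro sum.cong refl) auto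
  ultimately show ?case by simp
qed simp

text \<open>With \<open>rennala_iterate_cong\<close> this makes \<open>x\<^sup>k\<close> a measurable function of the samples of the
  iterations before \<open>k\<close>, from which its independence of later batches follows.\<close>

lemma rennala_iterate_measurable:
  fixes G :: "'e::euclidean_space \<Rightarrow> 'b \<Rightarrow> 'e"
  assumes G: "(\<lambda>(x, z). G x z) \<in> borel_measurable (borel \<Otimes>\<^sub>M D)"
    and "{..<k} \<times> {1..S} \<subseteq> A"
  shows "(\<lambda>w. rennala_iterate G \<gamma> S x0 (\<lambda>j s. w (j, s)) k) \<in> borel_measurable (PiM A (\<lambda>_. D))"
  using assms(2)
proof (induction k)
  case (Suc k)
  then have IH[measurable]:
    "(\<lambda>w. rennala_iterate G \<gamma> S x0 (\<lambda>j s. w (j, s)) k) \<in> borel_measurable (PiM A (\<lambda>_. D))"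
    by (auto simp: lessThan_Suc)
  have "(\<lambda>w. G (rennala_iterate G \<gamma> S x0 (\<lambda>j s. w (j, s)) k) (w (k, s)))
      \<in> borel_measurable (PiM A (\<lambda>_. D))" if "s \<in> {1..S}" for s
  proof -
    have [measurable]: "(\<lambda>w. w (k, s)) \<in> measurable (PiM A (\<lambda>_. D)) D"
      using Suc.prems that by (intro measurable_component_singleton) auto
    show ?thesis
      using measurable_compose[OF _ G, of "\<lambda>w. (rennala_iterate G \<gamma> S x0 (\<lambda>j s. w (j, s)) k, w (k, s))"]
      by simp
  qed
  then show ?case by simp
qed simp

locale minibatch_subgradient = prob_space P for P :: "'w measure" +
  fixes f :: "'e::euclidean_space \<Rightarrow> real" and G :: "'e \<Rightarrow> 'b \<Rightarrow> 'e" and D :: "'b measure"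
    and \<xi> :: "nat \<Rightarrow> nat \<Rightarrow> 'w \<Rightarrow> 'b" and S K :: nat and L V \<gamma> :: real and x0 :: 'e
  assumes convex: "convex_on UNIV f"
    and Lipschitz: "\<And>x y. \<bar>f x - f y\<bar> \<le> L * norm (x - y)" and L_nonneg: "0 \<le> L"
    and G_meas: "(\<lambda>(x, z). G x z) \<in> borel_measurable (borel \<Otimes>\<^sub>M D)"
    and G_int: "\<And>x. integrable D (G x)"
    and G_unbiased: "\<And>x. (\<integral>z. G x z \<partial>D) \<in> subdifferential f x"
    and G_sq_int: "\<And>x. integrable D (\<lambda>z. (norm (G x z - (\<integral>z'. G x z' \<partial>D)))\<^sup>2)"
    and G_variance: "\<And>x. (\<integral>z. (norm (G x z - (\<integral>z'. G x z' \<partial>D)))\<^sup>2 \<partial>D) \<le> V"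
    and indep: "indep_vars (\<lambda>_. D) (\<lambda>(k, s). \<xi> k s) ({..<K} \<times> {1..S})"
    and distr: "\<And>k s. k < K \<Longrightarrow> s \<in> {1..S} \<Longrightarrow> distr P D (\<xi> k s) = D"
    and S_pos: "1 \<le> S" and \<gamma>_pos: "0 < \<gamma>"
begin

abbreviation X :: "nat \<Rightarrow> 'w \<Rightarrow> 'e" where
  "X k \<omega> \<equiv> rennala_iterate G \<gamma> S x0 (\<lambda>j s. \<xi> j s \<omega>) k"

abbreviation sample :: "nat \<times> nat \<Rightarrow> 'w \<Rightarrow> 'b" where
  "sample \<equiv> \<lambda>(k, s). \<xi> k s"

text \<open>The samples keep their index pairs \<open>(k, s)\<close>, so that the batch of iteration \<open>k\<close> and the history
  before it are restrictions of one independent family to the disjoint index sets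
  \<open>{k} \<times> {1..S}\<close> and \<open>{..<k} \<times> {1..S}\<close>.\<close>

definition update :: "nat \<Rightarrow> 'e \<Rightarrow> (nat \<times> nat \<Rightarrow> 'b) \<Rightarrow> 'e" where
  "update k x w = x - \<gamma> *\<^sub>R ((1 / card ({k} \<times> {1..S})) *\<^sub>R (\<Sum>j\<in>{k} \<times> {1..S}. G x (w j)))"

lemma X_Suc: "X (Suc k) \<omega> = update k (X k \<omega>) (restrict (\<lambda>j. sample j \<omega>) ({k} \<times> {1..S}))"
proof -
  have "(\<Sum>j\<in>{k} \<times> {1..S}. G x (restrict (\<lambda>j. sample j \<omega>) ({k} \<times> {1..S}) j)) =
      (\<Sum>(j, s)\<in>{k} \<times> {1..S}. G x (\<xi> j s \<omega>))" for x
    by (intro sum.cong) auto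
  also have "\<dots> x = (\<Sum>s=1..S. G x (\<xi> k s \<omega>))" for x
    by (subst sum.cartesian_product[symmetric]) simp
  finally show ?thesis by (simp add: update_def)
qed

lemma X_eq_restrict:
  "X k \<omega> = rennala_iterate G \<gamma> S x0
     (\<lambda>j s. restrict (\<lambda>j. sample j \<omega>) ({..<k} \<times> {1..S}) (j, s)) k"
  by (rule rennala_iterate_cong) auto

lemma sample_measurable: "j \<in> {..<K} \<times> {1..S} \<Longrightarrow> sample j \<in> measurable P D"
  using indep unfolding indep_vars_def by blast

text \<open>Stated for the history of samples and not for the iterate itself, because \<open>indep_var\<close> relates
  variables with values in one type.\<close>

lemma history_indep_batch:
  assumes "k < K"
  shows "indep_var
    (PiM ({..<k} \<times> {1..S}) (\<lambda>_. D)) (\<lambda>\<omega>. restrict (\<lambda>j. sample j \<omega>) ({..<k} \<times> {1..S}))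
    (PiM ({k} \<times> {1..S}) (\<lambda>_. D)) (\<lambda>\<omega>. restrict (\<lambda>j. sample j \<omega>) ({k} \<times> {1..S}))"
  using assms by (intro indep_var_restrict[OF indep]) auto

lemma X_measurable:
  assumes "k \<le> K"
  shows "X k \<in> borel_measurable P"
proof -
  have "(\<lambda>\<omega>. restrict (\<lambda>j. sample j \<omega>) ({..<k} \<times> {1..S}))
      \<in> measurable P (PiM ({..<k} \<times> {1..S}) (\<lambda>_. D))"
    using assms by (intro measurable_restrict sample_measurable) auto
  from measurable_compose[OF this rennala_iterate_measurable[OF G_meas subset_refl]]
  have "(\<lambda>\<omega>. rennala_iterate G \<gamma> S x0
      (\<lambda>j s. restrict (\<lambda>j. sample j \<omega>) ({..<k} \<times> {1..S}) (j, s)) k) \<in> borel_measurable P" .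
  then show ?thesis by (simp only: X_eq_restrict[symmetric])
qed

lemma update_measurable:
  "(\<lambda>(x, w). update k x w) \<in> borel_measurable (borel \<Otimes>\<^sub>M PiM ({k} \<times> {1..S}) (\<lambda>_. D))"
proof -
  have "(\<lambda>(x, w). G x (w j)) \<in> borel_measurable (borel \<Otimes>\<^sub>M PiM ({k} \<times> {1..S}) (\<lambda>_. D))"
    if "j \<in> {k} \<times> {1..S}" for j
  proof -
    have [measurable]: "(\<lambda>w. w j) \<in> measurable (PiM ({k} \<times> {1..S}) (\<lambda>_. D)) D"
      using that by (intro measurable_component_singleton) auto
    show ?thesis
      using measurable_compose[OF _ G_meas,
          of "\<lambda>(x, w). (x, w j)" "borel \<Otimes>\<^sub>M PiM ({k} \<times> {1..S}) (\<lambda>_. D)"]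
      unfolding split_beta' fst_conv snd_conv by measurable
  qed
  then show ?thesis
    unfolding update_def by (simp add: split_beta')
qed

lemma V_nonneg: "0 \<le> V"
  using G_variance[of x0] by (rule order_trans[rotated]) simp

text \<open>The gap \<open>f x - f y\<close> stands on the left, since subtraction of extended nonnegative reals
  truncates.\<close>

lemma expected_update:
  assumes k: "k < K" and y: "f y \<le> f x"
  shows "(\<integral>\<^sup>+\<omega>. ennreal ((norm (update k x (restrict (\<lambda>j. sample j \<omega>) ({k} \<times> {1..S})) - y))\<^sup>2) \<partial>P)
    + ennreal (2 * \<gamma> * (f x - f y)) \<le> ennreal ((norm (x - y))\<^sup>2) + ennreal (\<gamma>\<^sup>2 * (L\<^sup>2 + V / S))"
proof -
  let ?J = "{k} \<times> {1..S}"
  define Z where "Z j \<omega> = G x (sample j \<omega>)" for j \<omega>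
  define g where "g = (\<integral>z. G x z \<partial>D)"
  have Gx[measurable]: "G x \<in> borel_measurable D"
    using G_int by (rule borel_measurable_integrable)
  have sm: "sample j \<in> measurable P D" and sd: "distr P D (sample j) = D" if "j \<in> ?J" for j
    using that k sample_measurable[of j] distr by auto
  have ind: "indep_vars (\<lambda>_. borel) Z ?J"
    unfolding Z_def
    by (rule indep_vars_compose2[OF indep_vars_subset[OF indep]]) (use k in auto)
  have transfer: "integrable P (\<lambda>\<omega>. h (sample j \<omega>))" "(\<integral>\<omega>. h (sample j \<omega>) \<partial>P) = (\<integral>z. h z \<partial>D)"
    if "j \<in> ?J" "integrable D h" for j and h :: "'b \<Rightarrow> 'c::{banach, second_countable_topology}"
    using integrable_distr_eq[OF sm[OF that(1)], of h] integral_distr[OF sm[OF that(1)], of h]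
      sd[OF that(1)] that(2) by auto
  have Z_int: "integrable P (Z j)" and Z_mean: "expectation (Z j) = g"
    and Z_sq: "integrable P (\<lambda>\<omega>. (norm (Z j \<omega> - g))\<^sup>2)"
    and Z_var: "expectation (\<lambda>\<omega>. (norm (Z j \<omega> - g))\<^sup>2) \<le> V" if "j \<in> ?J" for j
    using transfer[OF that G_int[of x]] transfer[OF that G_sq_int[of x]] G_variance[of x]
    unfolding Z_def g_def by simp_all
  have int: "integrable P (\<lambda>\<omega>. (norm ((x - y) - \<gamma> *\<^sub>R ((1 / card ?J) *\<^sub>R (\<Sum>j\<in>?J. Z j \<omega>))))\<^sup>2)"
    and le: "expectation (\<lambda>\<omega>. (norm ((x - y) - \<gamma> *\<^sub>R ((1 / card ?J) *\<^sub>R (\<Sum>j\<in>?J. Z j \<omega>))))\<^sup>2)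
      \<le> (norm (x - y))\<^sup>2 - 2 * \<gamma> * (g \<bullet> (x - y)) + \<gamma>\<^sup>2 * ((norm g)\<^sup>2 + V / card ?J)"
    using expected_minibatch_step[OF _ _ ind Z_int Z_mean Z_sq Z_var, of "x - y" \<gamma>] S_pos
    by auto
  have upd: "(norm (update k x (restrict (\<lambda>j. sample j \<omega>) ?J) - y))\<^sup>2
      = (norm ((x - y) - \<gamma> *\<^sub>R ((1 / card ?J) *\<^sub>R (\<Sum>j\<in>?J. Z j \<omega>))))\<^sup>2" for \<omega>
  proof -
    have "(\<Sum>j\<in>?J. G x (restrict (\<lambda>j. sample j \<omega>) ?J j)) = (\<Sum>j\<in>?J. Z j \<omega>)"
      by (intro sum.cong) (auto simp: Z_def)
    then show ?thesis
      unfolding update_def by (simp only:) (simp add: algebra_simps)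
  qed
  define E where "E = expectation (\<lambda>\<omega>. (norm ((x - y) - \<gamma> *\<^sub>R ((1 / card ?J) *\<^sub>R (\<Sum>j\<in>?J. Z j \<omega>))))\<^sup>2)"
  have "0 \<le> E" unfolding E_def by simp
  have sub: "g \<in> subdifferential f x" using G_unbiased by (simp add: g_def)
  have "f y \<ge> f x + g \<bullet> (y - x)"
    using sub by (simp add: subdifferential_def)
  then have "f x - f y \<le> g \<bullet> (x - y)" by (simp add: inner_diff_right)
  then have gap: "2 * \<gamma> * (f x - f y) \<le> 2 * \<gamma> * (g \<bullet> (x - y))"
    using \<gamma>_pos by simp
  have "norm g \<le> L"
    using subgradient_norm_le_Lipschitz[OF sub Lipschitz L_nonneg] .
  then have gL: "(norm g)\<^sup>2 \<le> L\<^sup>2" by (intro power_mono) auto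
  have "\<gamma>\<^sup>2 * ((norm g)\<^sup>2 + V / card ?J) \<le> \<gamma>\<^sup>2 * (L\<^sup>2 + V / S)"
    using gL by (intro mult_left_mono) auto
  with le gap have main: "E + 2 * \<gamma> * (f x - f y) \<le> (norm (x - y))\<^sup>2 + \<gamma>\<^sup>2 * (L\<^sup>2 + V / S)"
    unfolding E_def by linarith
  have c: "0 \<le> \<gamma>\<^sup>2 * (L\<^sup>2 + V / S)" using V_nonneg by simp
  have "(\<integral>\<^sup>+\<omega>. ennreal ((norm (update k x (restrict (\<lambda>j. sample j \<omega>) ?J) - y))\<^sup>2) \<partial>P) = ennreal E"
    unfolding upd E_def by (intro nn_integral_eq_integral int) auto
  moreover have "ennreal E + ennreal (2 * \<gamma> * (f x - f y))
      \<le> ennreal ((norm (x - y))\<^sup>2) + ennreal (\<gamma>\<^sup>2 * (L\<^sup>2 + V / S))"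
    using \<open>0 \<le> E\<close> main y c \<gamma>_pos by (simp flip: ennreal_plus add: ennreal_leI)
  ultimately show ?thesis by simp
qed

lemma f_measurable[measurable]: "f \<in> borel_measurable borel"
  using convex_on_continuous[OF open_UNIV convex] by (rule borel_measurable_continuous_onI)

text \<open>Working in \<open>ennreal\<close> avoids proving first that the iterates are square integrable; this comes
  out of the telescoped bound.\<close>

lemma expected_step:
  assumes k: "k < K" and y: "\<And>x. f y \<le> f x"
  shows "(\<integral>\<^sup>+\<omega>. ennreal ((norm (X (Suc k) \<omega> - y))\<^sup>2) \<partial>P)
      + (\<integral>\<^sup>+\<omega>. ennreal (2 * \<gamma> * (f (X k \<omega>) - f y)) \<partial>P)
    \<le> (\<integral>\<^sup>+\<omega>. ennreal ((norm (X k \<omega> - y))\<^sup>2) \<partial>P) + ennreal (\<gamma>\<^sup>2 * (L\<^sup>2 + V / S))"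
proof -
  let ?H = "PiM ({..<k} \<times> {1..S}) (\<lambda>_. D)" and ?B = "PiM ({k} \<times> {1..S}) (\<lambda>_. D)"
  let ?h = "\<lambda>\<omega>. restrict (\<lambda>j. sample j \<omega>) ({..<k} \<times> {1..S})"
  let ?b = "\<lambda>\<omega>. restrict (\<lambda>j. sample j \<omega>) ({k} \<times> {1..S})"
  define it where "it w = rennala_iterate G \<gamma> S x0 (\<lambda>j s. w (j, s)) k" for w :: "nat \<times> nat \<Rightarrow> 'b"
  have it_h: "it (?h \<omega>) = X k \<omega>" for \<omega>
    unfolding it_def by (rule X_eq_restrict[symmetric])
  have [measurable]: "X k \<in> borel_measurable P"
    using k by (intro X_measurable) auto
  have [measurable]: "it \<in> borel_measurable ?H"
    unfolding it_def by (rule rennala_iterate_measurable[OF G_meas subset_refl])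
  have [measurable]: "(\<lambda>(w, w'). update k (it w) w') \<in> borel_measurable (?H \<Otimes>\<^sub>M ?B)"
    using measurable_compose[OF _ update_measurable, of "\<lambda>(w, w'). (it w, w')" "?H \<Otimes>\<^sub>M ?B" k]
    unfolding split_beta' fst_conv snd_conv by measurable
  have upd: "(\<integral>\<^sup>+\<omega>. ennreal ((norm (X (Suc k) \<omega> - y))\<^sup>2) \<partial>P)
      = (\<integral>\<^sup>+\<omega>. (\<integral>\<^sup>+\<omega>'. ennreal ((norm (update k (X k \<omega>) (?b \<omega>') - y))\<^sup>2) \<partial>P) \<partial>P)"
    using nn_integral_indep_var[OF history_indep_batch[OF k],
        of "\<lambda>w w'. ennreal ((norm (update k (it w) w' - y))\<^sup>2)"]
    unfolding X_Suc it_h by measurable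
  have meas: "(\<lambda>\<omega>. \<integral>\<^sup>+\<omega>'. ennreal ((norm (update k (X k \<omega>) (?b \<omega>') - y))\<^sup>2) \<partial>P)
      \<in> borel_measurable P"
  proof -
    define b where "b = ?b"
    have [measurable]: "b \<in> measurable P ?B"
      unfolding b_def using k by (intro measurable_restrict sample_measurable) auto
    have "(\<lambda>(\<omega>, \<omega>'). update k (X k \<omega>) (b \<omega>')) \<in> borel_measurable (P \<Otimes>\<^sub>M P)"
      using measurable_compose[OF _ update_measurable,
          of "\<lambda>(\<omega>, \<omega>'). (X k \<omega>, b \<omega>')" "P \<Otimes>\<^sub>M P" k]
      unfolding split_beta' fst_conv snd_conv by measurable
    then show ?thesis
      unfolding b_def[THEN fun_cong, symmetric]
      by (intro borel_measurable_nn_integral) (simp add: split_beta')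
  qed
  have "(\<integral>\<^sup>+\<omega>. ennreal ((norm (X (Suc k) \<omega> - y))\<^sup>2) \<partial>P)
      + (\<integral>\<^sup>+\<omega>. ennreal (2 * \<gamma> * (f (X k \<omega>) - f y)) \<partial>P)
    = (\<integral>\<^sup>+\<omega>. (\<integral>\<^sup>+\<omega>'. ennreal ((norm (update k (X k \<omega>) (?b \<omega>') - y))\<^sup>2) \<partial>P)
        + ennreal (2 * \<gamma> * (f (X k \<omega>) - f y)) \<partial>P)"
    unfolding upd by (rule nn_integral_add[symmetric, OF meas]) measurable
  also have "\<dots> \<le> (\<integral>\<^sup>+\<omega>. ennreal ((norm (X k \<omega> - y))\<^sup>2) + ennreal (\<gamma>\<^sup>2 * (L\<^sup>2 + V / S)) \<partial>P)"
    by (intro nn_integral_mono expected_update k y)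
  also have "\<dots> = (\<integral>\<^sup>+\<omega>. ennreal ((norm (X k \<omega> - y))\<^sup>2) \<partial>P) + ennreal (\<gamma>\<^sup>2 * (L\<^sup>2 + V / S))"
    by (subst nn_integral_add) (auto simp: emeasure_space_1)
  finally show ?thesis .
qed

lemma total_expected_gap:
  assumes y: "\<And>x. f y \<le> f x" and "k \<le> K"
  shows "(\<integral>\<^sup>+\<omega>. ennreal ((norm (X k \<omega> - y))\<^sup>2) \<partial>P)
      + (\<Sum>j<k. \<integral>\<^sup>+\<omega>. ennreal (2 * \<gamma> * (f (X j \<omega>) - f y)) \<partial>P)
    \<le> ennreal ((norm (x0 - y))\<^sup>2 + k * (\<gamma>\<^sup>2 * (L\<^sup>2 + V / S)))"
  using \<open>k \<le> K\<close>
proof (induction k)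
  case 0
  then show ?case by (simp add: emeasure_space_1)
next
  case (Suc k)
  define c where "c = \<gamma>\<^sup>2 * (L\<^sup>2 + V / S)"
  let ?d = "\<lambda>k. \<integral>\<^sup>+\<omega>. ennreal ((norm (X k \<omega> - y))\<^sup>2) \<partial>P"
  let ?p = "\<lambda>k. \<integral>\<^sup>+\<omega>. ennreal (2 * \<gamma> * (f (X k \<omega>) - f y)) \<partial>P"
  have c: "0 \<le> c" using V_nonneg by (simp add: c_def)
  have "?d (Suc k) + (\<Sum>j<Suc k. ?p j) = (?d (Suc k) + ?p k) + (\<Sum>j<k. ?p j)"
    by (simp only: sum.lessThan_Suc ac_simps)
  also have "\<dots> \<le> (?d k + ennreal c) + (\<Sum>j<k. ?p j)"
    using Suc.prems by (intro add_right_mono expected_step[folded c_def] y) auto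
  also have "\<dots> = (?d k + (\<Sum>j<k. ?p j)) + ennreal c"
    by (simp only: ac_simps)
  also have "\<dots> \<le> ennreal ((norm (x0 - y))\<^sup>2 + k * c) + ennreal c"
    using Suc.prems by (intro add_right_mono Suc.IH[folded c_def]) auto
  also have "\<dots> = ennreal ((norm (x0 - y))\<^sup>2 + Suc k * c)"
    using c by (subst ennreal_plus[symmetric]) (auto simp: algebra_simps)
  finally show ?case by (simp only: c_def)
qed

text \<open>Convexity bounds \<open>f\<close> at the average by the average of \<open>f\<close>, to which the telescoped bound
  applies after division by \<open>2 * \<gamma> * K\<close>.\<close>

theorem expected_suboptimality:
  assumes y: "\<And>x. f y \<le> f x" and K: "0 < K"
  defines "xhat \<equiv> \<lambda>\<omega>. rennala_output G \<gamma> S x0 (\<lambda>k s. \<xi> k s \<omega>) K"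
  shows "integrable P (\<lambda>\<omega>. f (xhat \<omega>))"
    and "expectation (\<lambda>\<omega>. f (xhat \<omega>)) - f y
      \<le> (norm (x0 - y))\<^sup>2 / (2 * \<gamma> * K) + \<gamma> / 2 * (L\<^sup>2 + V / S)"
proof -
  define q where "q = L\<^sup>2 + V / S"
  define b where "b = (norm (x0 - y))\<^sup>2 / (2 * \<gamma> * K) + \<gamma> / 2 * q"
  have b: "0 \<le> b" using V_nonneg \<gamma>_pos by (simp add: b_def q_def)
  have [measurable]: "X k \<in> borel_measurable P" if "k < K" for k
    using that by (intro X_measurable) auto
  have xhat: "xhat \<omega> = (\<Sum>k<K. (1 / K) *\<^sub>R X k \<omega>)" for \<omega>
    using K by (simp add: xhat_def rennala_output_def scaleR_sum_right)
  have [measurable]: "xhat \<in> borel_measurable P"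
    unfolding xhat by measurable
  have gap: "2 * \<gamma> * K * (f (xhat \<omega>) - f y) \<le> (\<Sum>k<K. 2 * \<gamma> * (f (X k \<omega>) - f y))" for \<omega>
  proof -
    have "f (xhat \<omega>) \<le> (\<Sum>k<K. (1 / K) * f (X k \<omega>))"
      unfolding xhat using K by (intro convex_on_sum[OF _ _ convex]) auto
    then have "K * f (xhat \<omega>) \<le> (\<Sum>k<K. f (X k \<omega>))"
      using K by (simp add: field_simps flip: sum_divide_distrib)
    then have "K * (f (xhat \<omega>) - f y) \<le> (\<Sum>k<K. f (X k \<omega>) - f y)"
      by (simp add: sum_subtractf algebra_simps)
    then have "2 * \<gamma> * (K * (f (xhat \<omega>) - f y)) \<le> 2 * \<gamma> * (\<Sum>k<K. f (X k \<omega>) - f y)"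
      using \<gamma>_pos by (intro mult_left_mono) auto
    then show ?thesis by (simp add: sum_distrib_left mult.assoc)
  qed
  have "ennreal (2 * \<gamma> * K) * (\<integral>\<^sup>+\<omega>. ennreal (f (xhat \<omega>) - f y) \<partial>P)
      = (\<integral>\<^sup>+\<omega>. ennreal (2 * \<gamma> * K * (f (xhat \<omega>) - f y)) \<partial>P)"
    using \<gamma>_pos y by (subst nn_integral_cmult[symmetric]) (auto simp: ennreal_mult)
  also have "\<dots> \<le> (\<integral>\<^sup>+\<omega>. (\<Sum>k<K. ennreal (2 * \<gamma> * (f (X k \<omega>) - f y))) \<partial>P)"
    using gap \<gamma>_pos y by (intro nn_integral_mono) (auto simp: sum_ennreal intro!: ennreal_leI)
  also have "\<dots> = (\<Sum>k<K. \<integral>\<^sup>+\<omega>. ennreal (2 * \<gamma> * (f (X k \<omega>) - f y)) \<partial>P)"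
    by (rule nn_integral_sum) auto
  also have "\<dots> \<le> ennreal ((norm (x0 - y))\<^sup>2 + K * (\<gamma>\<^sup>2 * q))"
    unfolding q_def by (rule order_trans[OF _ total_expected_gap[OF y order_refl]]) simp
  also have "\<dots> = ennreal (2 * \<gamma> * K) * ennreal b"
  proof -
    have "(norm (x0 - y))\<^sup>2 + K * (\<gamma>\<^sup>2 * q) = 2 * \<gamma> * K * b"
      using K \<gamma>_pos by (simp add: b_def power2_eq_square field_simps)
    then show ?thesis
      using \<gamma>_pos b by (simp add: ennreal_mult)
  qed
  finally have le: "(\<integral>\<^sup>+\<omega>. ennreal (f (xhat \<omega>) - f y) \<partial>P) \<le> ennreal b"
    using K \<gamma>_pos by (subst (asm) ennreal_mult_le_mult_iff) auto
  have int: "integrable P (\<lambda>\<omega>. f (xhat \<omega>) - f y)"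
    using le y by (intro integrableI_nonneg) (auto simp: le_less_trans)
  from Bochner_Integration.integrable_add[OF this integrable_const[of "f y"]]
  show int': "integrable P (\<lambda>\<omega>. f (xhat \<omega>))" by simp
  have "expectation (\<lambda>\<omega>. f (xhat \<omega>) - f y) \<le> b"
    using le y b int by (subst (asm) nn_integral_eq_integral) auto
  then show "expectation (\<lambda>\<omega>. f (xhat \<omega>)) - f y
      \<le> (norm (x0 - y))\<^sup>2 / (2 * \<gamma> * K) + \<gamma> / 2 * (L\<^sup>2 + V / S)"
    using int' by (simp add: prob_space b_def q_def)
qed

end

section \<open>Rennala SGD\<close>

theorem theoremH6:
  fixes f :: "real ^ 'd \<Rightarrow> real" and xstar x0 :: "real ^ 'd"
    and M :: ereal and \<sigma> \<epsilon> R \<gamma> :: real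
    and G :: "real ^ 'd \<Rightarrow> 'b \<Rightarrow> real ^ 'd" and D :: "'b measure"
    and P :: "'w measure" and \<xi> :: "nat \<Rightarrow> nat \<Rightarrow> 'w \<Rightarrow> 'b"
    and v :: "nat \<Rightarrow> real \<Rightarrow> real" and n S K :: nat
  assumes f_convex: "convex_on UNIV f"
    and f_min: "\<And>x. f xstar \<le> f x"
    and M_pos: "0 < M"
    and f_Lipschitz: "\<And>x y. ereal \<bar>f x - f y\<bar> \<le> M * ereal (norm (x - y))"
    and D_prob: "prob_space D"
    and G_meas: "(\<lambda>(x, z). G x z) \<in> borel_measurable (borel \<Otimes>\<^sub>M D)"
    and G_int: "\<And>x. integrable D (G x)"
    and G_unbiased: "\<And>x. (\<integral>z. G x z \<partial>D) \<in> subdifferential f x"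
    and G_sq_int: "\<And>x. integrable D (\<lambda>z. (norm (G x z - (\<integral>z'. G x z' \<partial>D)))\<^sup>2)"
    and G_variance: "\<And>x. (\<integral>z. (norm (G x z - (\<integral>z'. G x z' \<partial>D)))\<^sup>2 \<partial>D) \<le> \<sigma>\<^sup>2"
    and v_nonneg: "\<And>i \<tau>. i \<in> {1..n} \<Longrightarrow> 0 \<le> \<tau> \<Longrightarrow> 0 \<le> v i \<tau>"
    and v_cont_ae: "\<And>i. i \<in> {1..n} \<Longrightarrow>
          negligible {\<tau>. 0 \<le> \<tau> \<and> \<not> continuous (at \<tau> within {0..}) (v i)}"
    and v_int: "\<And>i t. i \<in> {1..n} \<Longrightarrow> 0 \<le> t \<Longrightarrow> v i integrable_on {0..t}"
    and eps_pos: "0 < \<epsilon>"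
    and R_eq: "R = norm (xstar - x0)"
    and S_eq: "ereal (real S) = max (ereal_ceiling (ereal (\<sigma>\<^sup>2) / M\<^sup>2)) 1"
    and gamma_eq: "ereal \<gamma> = ereal \<epsilon> / (M\<^sup>2 + ereal (\<sigma>\<^sup>2 / real S))"
    and K_eq: "ereal (real K) = ereal_ceiling (2 * M\<^sup>2 * ereal (R\<^sup>2) / ereal (\<epsilon>\<^sup>2))"
    and P_prob: "prob_space P"
    and xi_indep: "prob_space.indep_vars P (\<lambda>_. D) (\<lambda>(k, s). \<xi> k s) ({..<K} \<times> {1..S})"
    and xi_distr: "\<And>k s. k < K \<Longrightarrow> s \<in> {1..S} \<Longrightarrow> distr P D (\<xi> k s) = D"
  shows "ereal \<epsilon> / (2 * M\<^sup>2) \<le> ereal \<gamma> \<and> ereal \<gamma> \<le> ereal \<epsilon> / M\<^sup>2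
    \<and> (let xhat = (\<lambda>\<omega>. rennala_output G \<gamma> S x0 (\<lambda>k s. \<xi> k s \<omega>) K) in
         integrable P (\<lambda>\<omega>. f (xhat \<omega>)) \<and> (\<integral>\<omega>. f (xhat \<omega>) \<partial>P) - f xstar \<le> \<epsilon>)
    \<and> (int S \<le> max \<lceil>\<sigma>\<^sup>2 / \<epsilon>\<rceil> 1
         \<longrightarrow> rennala_time v n S K \<le> t_bar v n (max \<lceil>\<sigma>\<^sup>2 / \<epsilon>\<rceil> 1) K)
    \<and> rennala_time v n S K \<le> t_bar v n (int S) K"
proof -
  have S_pos: "1 \<le> S"
  proof -
    have "1 \<le> ereal (real S)" unfolding S_eq by simp
    then show ?thesis by (simp add: one_ereal_def)
  qed
  have times: "(int S \<le> max \<lceil>\<sigma>\<^sup>2 / \<epsilon>\<rceil> 1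
         \<longrightarrow> rennala_time v n S K \<le> t_bar v n (max \<lceil>\<sigma>\<^sup>2 / \<epsilon>\<rceil> 1) K)
    \<and> rennala_time v n S K \<le> t_bar v n (int S) K"
    using v_int v_nonneg S_pos by (auto intro!: rennala_time_le_t_bar)
  let ?xhat = "\<lambda>\<omega>. rennala_output G \<gamma> S x0 (\<lambda>k s. \<xi> k s \<omega>) K"
  interpret P: prob_space P by (rule P_prob)
  have R_zero: "integrable P (\<lambda>\<omega>. f (?xhat \<omega>)) \<and> (\<integral>\<omega>. f (?xhat \<omega>) \<partial>P) - f xstar \<le> \<epsilon>"
    if "R = 0" "K = 0"
    using that R_eq eps_pos by (simp add: rennala_output_def P.prob_space)
  have "(ereal \<epsilon> / (2 * M\<^sup>2) \<le> ereal \<gamma> \<and> ereal \<gamma> \<le> ereal \<epsilon> / M\<^sup>2)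
    \<and> integrable P (\<lambda>\<omega>. f (?xhat \<omega>)) \<and> (\<integral>\<omega>. f (?xhat \<omega>) \<partial>P) - f xstar \<le> \<epsilon>"
  proof (cases M)
    case PInf
    \<comment> \<open>Here \<open>\<infinity> * 0 = 0\<close> is in force, so only \<open>R = 0\<close> is compatible with a finite \<open>K\<close>.\<close>
    have "R = 0"
    proof (rule ccontr)
      assume "R \<noteq> 0"
      then have "2 * M\<^sup>2 * ereal (R\<^sup>2) / ereal (\<epsilon>\<^sup>2) = \<infinity>"
        using PInf eps_pos by simp
      then show False using K_eq by (simp add: ereal_ceiling_def)
    qed
    then have "K = 0"
      using K_eq PInf eps_pos by (simp add: ereal_ceiling_def zero_ereal_def)
    moreover have "\<gamma> = 0"
      using gamma_eq PInf by simp
    ultimately show ?thesis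
      using R_zero \<open>R = 0\<close> PInf by (simp add: zero_ereal_def)
  next
    case MInf
    then show ?thesis using M_pos by simp
  next
    case (real m)
    have m: "0 < m" using M_pos real by simp
    have Lip: "\<bar>f x - f y\<bar> \<le> m * norm (x - y)" for x y
      using f_Lipschitz[of x y] real by simp
    have S_ge: "\<sigma>\<^sup>2 / m\<^sup>2 \<le> S"
    proof -
      have "ereal_ceiling (ereal (\<sigma>\<^sup>2) / M\<^sup>2) \<le> ereal (real S)" unfolding S_eq by simp
      then have "real_of_int \<lceil>\<sigma>\<^sup>2 / m\<^sup>2\<rceil> \<le> S"
        using real m by (simp add: ereal_ceiling_def)
      then show ?thesis by linarith
    qed
    define q where "q = m\<^sup>2 + \<sigma>\<^sup>2 / S"
    have "\<sigma>\<^sup>2 / S \<le> m\<^sup>2"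
      using S_ge m S_pos by (simp add: field_simps)
    then have q: "0 < m\<^sup>2" "m\<^sup>2 \<le> q" "q \<le> 2 * m\<^sup>2" "0 < q"
      using m by (auto simp: q_def add_pos_nonneg)
    have \<gamma>: "\<gamma> = \<epsilon> / q"
      using gamma_eq real q by (simp add: q_def)
    have "\<epsilon> / (2 * m\<^sup>2) \<le> \<gamma>" "\<gamma> \<le> \<epsilon> / m\<^sup>2"
      unfolding \<gamma> using q eps_pos by (intro divide_left_mono; simp)+
    then have range: "ereal \<epsilon> / (2 * M\<^sup>2) \<le> ereal \<gamma> \<and> ereal \<gamma> \<le> ereal \<epsilon> / M\<^sup>2"
      using real m by simp
    have "2 * M\<^sup>2 * ereal (R\<^sup>2) / ereal (\<epsilon>\<^sup>2) = ereal (2 * m\<^sup>2 * R\<^sup>2 / \<epsilon>\<^sup>2)"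
      using real eps_pos by simp
    then have K: "real K = \<lceil>2 * m\<^sup>2 * R\<^sup>2 / \<epsilon>\<^sup>2\<rceil>"
      using K_eq by (simp add: ereal_ceiling_def)
    then have K_ge: "2 * m\<^sup>2 * R\<^sup>2 / \<epsilon>\<^sup>2 \<le> K" by linarith
    show ?thesis
    proof (cases "K = 0")
      case True
      then have "2 * m\<^sup>2 * R\<^sup>2 / \<epsilon>\<^sup>2 \<le> 0" using K_ge by simp
      then have "R = 0"
        using m eps_pos by (simp add: divide_le_0_iff mult_le_0_iff)
      then show ?thesis using R_zero True range by blast
    next
      case False
      have "0 < \<gamma>" using \<gamma> q eps_pos by simp
      then interpret minibatch_subgradient P f G D \<xi> S K m "\<sigma>\<^sup>2" \<gamma> x0
        using f_convex Lip m G_meas G_int G_unbiased G_sq_int G_variance xi_indep xi_distr S_pos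
        by unfold_locales auto
      have "0 < K" using False by simp
      note bound = expected_suboptimality[OF f_min this]
      have "R\<^sup>2 / (2 * \<gamma> * K) \<le> \<epsilon> / 2"
      proof -
        have "R\<^sup>2 * q \<le> R\<^sup>2 * (2 * m\<^sup>2)"
          using q by (intro mult_left_mono) auto
        also have "\<dots> \<le> \<epsilon>\<^sup>2 * K"
          using K_ge eps_pos by (simp add: field_simps)
        finally show ?thesis
          using eps_pos q False by (simp add: \<gamma> field_simps power2_eq_square)
      qed
      moreover have "\<gamma> / 2 * (m\<^sup>2 + \<sigma>\<^sup>2 / S) = \<epsilon> / 2"
        using q by (simp add: \<gamma> q_def[symmetric])
      ultimately have "(\<integral>\<omega>. f (?xhat \<omega>) \<partial>P) - f xstar \<le> \<epsilon>"
        using bound(2) by (simp add: R_eq norm_minus_commute)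
      then show ?thesis using bound(1) range by blast
    qed
  qed
  with times show ?thesis by (simp add: Let_def)
qed

end
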